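(* Let $q$ be a prime power and $k\geq 2$ an integer. The curve over $\mathbb{F}_{q^k}$ given by $$y^{q^{k-1}}+\cdots+y^q+y=x^{q+1}+x^{1+q^2}+\cdots+x^{q^{k-1}+q^{k-2}},$$ where the right-hand side is $\sum_{0\le i<j\le k-1}x^{q^i+q^j}$, is $q^k$-Frobenius nonclassical.
   Context: The right-hand side is $s_2(x,x^q,\ldots,x^{q^{k-1}})$, where $s_2(x_1,\ldots,x_k)=\sum_{i<j}x_ix_j$ is the second elementary symmetric polynomial; this is the generalized Hermitian curve of Garcia and Stichtenoth. For a prime power $Q$, an (absolutely) irreducible plane curve $F(x,y)=0$ with $F\in\mathbb{F}_Q[x,y]$ is called $Q$-Frobenius nonclassical if $F$ divides $(x^Q-x)\frac{\partial F}{\partial x}+(y^Q-y)\frac{\partial F}{\partial y}$. *)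

theory Defs
  imports
    "HOL-Algebra.Algebraic_Closure_Type"
    "HOL-Number_Theory.Prime_Powers"
    "HOL-Library.Cardinality"
begin

text \<open>
  A bivariate polynomial in x and y is an element of \<open>'a poly poly\<close>: a polynomial in the outer
  variable y whose coefficients are polynomials in the inner variable x.
\<close>

definition xvar :: "'a::comm_semiring_1 poly poly" where
  "xvar = [:[:0, 1:]:]"

definition yvar :: "'a::comm_semiring_1 poly poly" where
  "yvar = [:0, 1:]"

definition partial_x :: "'a::idom poly poly \<Rightarrow> 'a poly poly" where
  "partial_x F = map_poly pderiv F"

definition partial_y :: "'a::idom poly poly \<Rightarrow> 'a poly poly" where
  "partial_y F = pderiv F"

definition absolutely_irreducible :: "'a::field poly poly \<Rightarrow> bool" where
  "absolutely_irreducible F \<longleftrightarrow>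
     irreducible (map_poly (map_poly (to_ac :: 'a \<Rightarrow> 'a alg_closure)) F)"

text \<open>
  The base field of \<open>Q\<close> elements is the type \<open>'a\<close>; a finite field has prime power cardinality,
  so this is not required of \<open>Q\<close> separately.
\<close>

definition Frobenius_nonclassical :: "nat \<Rightarrow> 'a::{field,finite} poly poly \<Rightarrow> bool" where
  "Frobenius_nonclassical Q F \<longleftrightarrow>
     CARD('a) = Q \<and>
     absolutely_irreducible F \<and>
     F dvd (xvar ^ Q - xvar) * partial_x F + (yvar ^ Q - yvar) * partial_y F"

definition generalized_Hermitian :: "nat \<Rightarrow> nat \<Rightarrow> 'a::field poly poly" where
  "generalized_Hermitian q k =
     (\<Sum>i<k. yvar ^ (q ^ i)) - (\<Sum>j<k. \<Sum>i<j. xvar ^ (q ^ i + q ^ j))"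

end

theory Submission
  imports Defs "HOL-Number_Theory.Residues"
begin

text \<open>
  The curve has the shape \<open>T(y) = S(x)\<close> with \<open>T' = 1\<close> and \<open>S' = x\<^sup>q + \<dots> + x^q^(k-1)\<close>.
  If \<open>T(y) - S(x) = G H\<close>, then \<open>G\<^sub>y H + G H\<^sub>y = 1\<close>, so \<open>G\<close> and \<open>H\<close> are comaximal. As the
  derivation \<open>D = \<partial>\<^sub>x + S' \<partial>\<^sub>y\<close> annihilates \<open>G H\<close>, \<open>G\<close> divides \<open>D G\<close>, and since \<open>D\<close> lowers the
  degree in \<open>y\<close>, \<open>D G = 0\<close>; likewise \<open>D H = 0\<close>. Specializing \<open>y\<close> to a generic constant, both
  factors become polynomials in \<open>x\<close> whose derivative is a nonzero multiple of \<open>S'\<close>, hence of degree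
  greater than \<open>deg S' = q^(k-1)\<close>, while their product has degree at most
  \<open>deg S \<le> q^(k-1) + q^(k-2)\<close>.

  The Frobenius condition holds because \<open>T\<^sup>q - T = y^q^k - y\<close> and
  \<open>S\<^sup>q - S = (x^q^k - x) S'\<close>, so that the polynomial to be divided is \<open>F\<^sup>q - F\<close>.
\<close>

section \<open>Preliminaries on roots and derivatives\<close>

lemma infinite_UNIV_alg_closed: "infinite (UNIV :: 'a :: alg_closed_field set)"
proof
  assume fin: "finite (UNIV :: 'a set)"
  \<comment> \<open>Euclid's device: \<open>P\<close> vanishes at every element, so
    \<open>P + 1\<close> would have positive degree and no root.\<close>
  define P :: "'a poly" where "P = (\<Prod>a\<in>UNIV. [:-a, 1:])"
  have "degree P = card (UNIV :: 'a set)"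
    unfolding P_def by (subst degree_prod_eq_sum_degree) auto
  moreover have "card (UNIV :: 'a set) > 0"
    using fin by (simp add: card_gt_0_iff)
  ultimately have "degree (P + 1) > 0"
    by (metis degree_1 degree_add_eq_left)
  then obtain z where "poly (P + 1) z = 0"
    using alg_closed_imp_poly_has_root by blast
  moreover have "poly P z = 0"
    using fin by (auto simp: P_def poly_prod)
  ultimately show False
    by simp
qed

lemma pderiv_sum: "pderiv (\<Sum>i\<in>A. f i) = (\<Sum>i\<in>A. pderiv (f i))"
  by (induction A rule: infinite_finite_induct) (simp_all add: pderiv_add)

text \<open>In positive characteristic the degree may drop by more than one, so only an inequality
  is available.\<close>

lemma degree_pderiv_less:
  fixes p :: "'a::idom poly"
  assumes "pderiv p \<noteq> 0"
  shows "degree (pderiv p) < degree p"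
proof -
  have "coeff (pderiv p) (degree (pderiv p)) \<noteq> 0"
    using assms by simp
  then have "coeff p (Suc (degree (pderiv p))) \<noteq> 0"
    by (auto simp: coeff_pderiv)
  then show ?thesis
    by (intro Suc_le_lessD le_degree)
qed

lemma partial_x_mult: "partial_x (G * H) = partial_x G * H + G * partial_x H"
  by (rule poly_eqI)
     (simp add: partial_x_def coeff_map_poly coeff_mult pderiv_sum pderiv_mult sum.distrib,
      simp add: mult.commute)

lemma partial_y_mult: "partial_y (G * H) = partial_y G * H + G * partial_y H"
  by (simp add: partial_y_def pderiv_mult)

lemma poly_partial_x_const: "poly (partial_x G) [:c:] = pderiv (poly G [:c:])"
  unfolding partial_x_def
  by (induction G rule: pCons_induct)
     (simp_all add: map_poly_pCons pderiv_add pderiv_smult)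

section \<open>Irreducibility of \<open>T(y) - S(x)\<close>\<close>

text \<open>This is \<open>T(y) - S(x)\<close>: the coefficients of \<open>T\<close> become
  constants in x, so \<open>T\<close> is read in the outer variable.\<close>

definition separated :: "'a::comm_ring_1 poly \<Rightarrow> 'a poly \<Rightarrow> 'a poly poly" where
  "separated T S = map_poly (\<lambda>c. [:c:]) T - [:S:]"

lemma partial_x_separated: "partial_x (separated T S) = [:- pderiv S:]"
  by (intro poly_eqI)
     (simp add: separated_def partial_x_def coeff_map_poly pderiv_diff pderiv_minus coeff_pCons
        split: nat.split)

lemma partial_y_separated:
  assumes "pderiv T = 1"
  shows "partial_y (separated T S) = 1"
proof (rule poly_eqI)
  fix n
  have "coeff (pderiv T) n = coeff 1 n"
    using assms by simp
  then have *: "of_nat (Suc n) * coeff T (Suc n) = (if n = 0 then 1 else 0)"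
    by (simp add: coeff_pderiv)
  have "coeff (partial_y (separated T S)) n = of_nat (Suc n) * [:coeff T (Suc n):]"
    by (simp add: partial_y_def separated_def coeff_pderiv coeff_map_poly del: of_nat_Suc)
  also have "\<dots> = [:of_nat (Suc n) * coeff T (Suc n):]"
    by (simp add: of_nat_poly del: of_nat_Suc)
  finally show "coeff (partial_y (separated T S)) n = coeff 1 n"
    using * by (simp add: one_pCons coeff_pCons split: nat.split)
qed

lemma poly_separated_const: "poly (separated T S) [:c:] = [:poly T c:] - S"
proof -
  have "poly (map_poly (\<lambda>c. [:c:]) T) [:c:] = [:poly T c:]"
    by (induction T rule: pCons_induct) (simp_all add: map_poly_pCons)
  then show ?thesis
    by (simp add: separated_def)
qed

text \<open>The leading coefficient in y has to be constant in x: this is what makes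
  \<open>D\<close> lower the y-degree of \<open>G\<close> strictly, so that \<open>G dvd D G\<close>
  forces \<open>D G = 0\<close>.\<close>

lemma factor_separated_annihilated:
  fixes G H :: "'a::idom poly poly"
  assumes T': "pderiv T = 1"
    and eq: "separated T S = G * H"
    and lead: "lead_coeff G dvd 1"
    and const: "degree (lead_coeff G) = 0"
    and deg: "degree G > 0"
  shows "partial_x G + [:pderiv S:] * partial_y G = 0"
proof -
  define D where "D G = partial_x G + [:pderiv S:] * partial_y G" for G :: "'a poly poly"
  have one: "partial_y G * H + G * partial_y H = 1"
    using partial_y_separated[OF T', of S] by (simp add: eq partial_y_mult)
  have "D (separated T S) = 0"
    by (simp add: D_def partial_x_separated partial_y_separated[OF T'])
  then have "D G * H = G * (- D H)"
    unfolding eq by (simp add: D_def partial_x_mult partial_y_mult algebra_simps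
        add_eq_0_iff)
  then have "G dvd D G * H * partial_y G"
    by simp
  \<comment> \<open>The identity \<open>one\<close>, multiplied by \<open>D G\<close>.\<close>
  moreover have "D G = D G * H * partial_y G + G * (D G * partial_y H)"
    using arg_cong[OF one, of "\<lambda>z. D G * z"] by (simp add: algebra_simps)
  ultimately have "G dvd D G"
    by (metis dvd_add dvd_triv_left)
  then obtain E where E: "D G = G * E" ..
  have "degree (D G) < degree G"
  proof -
    have "coeff (D G) n = 0" if "n \<ge> degree G" for n
    proof -
      have "coeff (partial_y G) n = 0"
        using that by (simp add: partial_y_def coeff_pderiv coeff_eq_0)
      moreover have "coeff (partial_x G) n = 0"
      proof (cases "n = degree G")
        case True
        then show ?thesis
          using const by (auto simp: partial_x_def coeff_map_poly elim: degree_eq_zeroE)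
      next
        case False
        then show ?thesis
          using that by (simp add: partial_x_def coeff_map_poly coeff_eq_0)
      qed
      ultimately show ?thesis
        by (simp add: D_def)
    qed
    then show ?thesis
      using deg by (metis leading_coeff_0_iff degree_0 not_le)
  qed
  moreover have "G \<noteq> 0"
    using deg by auto
  ultimately have "E = 0"
    unfolding E by (cases "E = 0") (auto simp: degree_mult_eq)
  then show ?thesis
    using E by (simp add: D_def)
qed

text \<open>The degree hypothesis rules out that \<open>S\<close> minus a constant is a product of
  two polynomials of degree greater than that of \<open>pderiv S\<close>.\<close>

lemma irreducible_separated:
  fixes T S :: "'a::alg_closed_field poly"
  assumes T': "pderiv T = 1"
    and S': "pderiv S \<noteq> 0"
    and deg: "degree S < 2 * (degree (pderiv S) + 1)"
  shows "irreducible (separated T S)"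
proof (rule irreducibleI)
  define F where "F = separated T S"
  have Fy: "partial_y F = 1"
    unfolding F_def by (rule partial_y_separated[OF T'])
  have degT: "degree T > 0"
    using T' by (cases "degree T = 0") (auto elim: degree_eq_zeroE)
  have degmap: "degree (map_poly (\<lambda>c. [:c:]) T) = degree T"
    by (rule map_poly_degree_eq) (use degT in auto)
  have degF: "degree F = degree T"
    using degree_add_eq_left[of "- [:S:]" "map_poly (\<lambda>c. [:c:]) T"] degT degmap
    by (simp add: F_def separated_def del: minus_pCons)
  have leadF: "lead_coeff F = [:lead_coeff T:]"
    unfolding degF using degT
    by (simp add: F_def separated_def coeff_map_poly coeff_pCons split: nat.split)
  show "separated T S \<noteq> 0"
    using degF degT by (auto simp: F_def)
  show "\<not> separated T S dvd 1"
    using degF degT by (auto simp: F_def is_unit_poly_iff)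
  fix G H
  assume eq: "separated T S = G * H"
  show "G dvd 1 \<or> H dvd 1"
  proof (rule ccontr)
    assume nonunit: "\<not> (G dvd 1 \<or> H dvd 1)"
    have one: "partial_y G * H + G * partial_y H = 1"
      using Fy by (simp add: F_def eq partial_y_mult)
    have "lead_coeff G * lead_coeff H = [:lead_coeff T:]"
      using leadF by (simp add: F_def eq lead_coeff_mult)
    moreover have "[:lead_coeff T:] dvd 1"
      using degT by (auto simp: is_unit_pCons_iff)
    ultimately have lead: "lead_coeff G dvd 1" "lead_coeff H dvd 1"
      by (metis dvd_mult_left, metis dvd_mult_right)
    \<comment> \<open>Stated for arbitrary \<open>A\<close> and \<open>B\<close> so that it serves
      both factors: \<open>D A = 0\<close> at \<open>y = c\<close> exhibits the derivative of
      \<open>A(x, c)\<close> as a nonzero multiple of \<open>pderiv S\<close>.\<close>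
    have factor: "degree (poly A [:c:]) > degree (pderiv S)"
      if eq': "separated T S = A * B" and lead': "lead_coeff A dvd 1" and nonunit': "\<not> A dvd 1"
        and nz: "poly (partial_y A) [:c:] \<noteq> 0" for A B c
    proof -
      have "degree (lead_coeff A) = 0"
        using lead' by (auto simp: is_unit_poly_iff)
      moreover have "degree A > 0"
        using lead' nonunit' by (cases "degree A = 0") (auto simp: is_unit_const_poly_iff elim!: degree_eq_zeroE)
      ultimately have "partial_x A + [:pderiv S:] * partial_y A = 0"
        using factor_separated_annihilated[OF T' eq' lead'] by blast
      then have "poly (partial_x A + [:pderiv S:] * partial_y A) [:c:] = 0"
        by simp
      then have *: "pderiv (poly A [:c:]) = - (pderiv S * poly (partial_y A) [:c:])"
        by (simp add: poly_partial_x_const add_eq_0_iff2)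
      then have "degree (pderiv (poly A [:c:])) \<ge> degree (pderiv S)"
        using S' nz by (simp add: degree_mult_eq)
      moreover have "pderiv (poly A [:c:]) \<noteq> 0"
        using * S' nz by simp
      ultimately show ?thesis
        using degree_pderiv_less[of "poly A [:c:]"] by linarith
    qed
    \<comment> \<open>If one of these derivatives vanished, \<open>one\<close> would make the
      corresponding factor a unit.\<close>
    have "partial_y G \<noteq> 0" "partial_y H \<noteq> 0"
      using one nonunit by (auto simp: dvd_def mult.commute)
    then have "partial_y G * partial_y H \<noteq> 0"
      by simp
    then have "finite {z. poly (partial_y G * partial_y H) z = 0}"
      by (rule poly_roots_finite)
    \<comment> \<open>The roots lie in the ring of polynomials in x; infinitely many constants are
      available, so some constant \<open>c\<close> is not a root.\<close>
    moreover have "infinite (range (\<lambda>c::'a. [:c:]))"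
      using infinite_UNIV_alg_closed by (auto dest: finite_imageD simp: inj_on_def)
    ultimately have "\<not> range (\<lambda>c::'a. [:c:]) \<subseteq> {z. poly (partial_y G * partial_y H) z = 0}"
      using finite_subset by metis
    then obtain c :: 'a where "poly (partial_y G * partial_y H) [:c:] \<noteq> 0"
      by auto
    then have nz: "poly (partial_y G) [:c:] \<noteq> 0" "poly (partial_y H) [:c:] \<noteq> 0"
      by auto
    have eq': "separated T S = H * G"
      by (simp only: eq mult.commute)
    have degG: "degree (poly G [:c:]) > degree (pderiv S)"
      by (rule factor[OF eq lead(1) _ nz(1)]) (use nonunit in blast)
    have degH: "degree (poly H [:c:]) > degree (pderiv S)"
      by (rule factor[OF eq' lead(2) _ nz(2)]) (use nonunit in blast)
    have "poly G [:c:] \<noteq> 0" "poly H [:c:] \<noteq> 0"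
      using degG degH by (metis degree_0 not_less_zero)+
    then have "2 * (degree (pderiv S) + 1) \<le> degree (poly G [:c:] * poly H [:c:])"
      using degG degH by (simp add: degree_mult_eq)
    also have "poly G [:c:] * poly H [:c:] = [:poly T c:] - S"
      using poly_separated_const[of T S c] by (simp add: eq)
    also have "degree \<dots> \<le> degree S"
      by (rule degree_diff_le) auto
    finally show False
      using deg by simp
  qed
qed

section \<open>The generalized Hermitian curve in separated form\<close>

definition Hermitian_y :: "nat \<Rightarrow> nat \<Rightarrow> 'a::comm_ring_1 poly" where
  "Hermitian_y q k = (\<Sum>i<k. monom 1 (q ^ i))"

definition Hermitian_x :: "nat \<Rightarrow> nat \<Rightarrow> 'a::comm_ring_1 poly" where
  "Hermitian_x q k = (\<Sum>j<k. \<Sum>i<j. monom 1 (q ^ i + q ^ j))"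

lemma xvar_power: "xvar ^ n = [:monom 1 n:]"
  by (induction n) (simp_all add: xvar_def monom_Suc one_pCons monom_0)

lemma yvar_power: "yvar ^ n = monom 1 n"
  by (simp add: yvar_def monom_altdef)

lemma const_poly_sum: "(\<Sum>i\<in>A. [:f i:]) = [:\<Sum>i\<in>A. f i:]"
  by (induction A rule: infinite_finite_induct) simp_all

lemma generalized_Hermitian_separated:
  "generalized_Hermitian q k = separated (Hermitian_y q k) (Hermitian_x q k)"
proof -
  have "map_poly (\<lambda>c. [:c:]) (\<Sum>i<k. monom 1 (q ^ i)) = (\<Sum>i<k. monom (1::'a poly) (q ^ i))"
    by (intro poly_eqI)
       (auto simp: coeff_map_poly coeff_sum one_pCons simp flip: const_poly_sum intro!: sum.cong)
  then show ?thesis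
    by (simp add: generalized_Hermitian_def separated_def Hermitian_y_def Hermitian_x_def
        xvar_power yvar_power const_poly_sum)
qed

text \<open>Reduces absolute irreducibility to irreducibility of the same formula over the algebraic
  closure.\<close>

lemma map_to_ac_generalized_Hermitian:
  "map_poly (map_poly to_ac) (generalized_Hermitian q k :: 'a::field poly poly) =
    generalized_Hermitian q k"
proof -
  have "map_poly to_ac (Hermitian_x q k :: 'a poly) = Hermitian_x q k"
    "map_poly to_ac (Hermitian_y q k :: 'a poly) = Hermitian_y q k"
    by (intro poly_eqI;
        simp add: Hermitian_x_def Hermitian_y_def coeff_map_poly coeff_sum to_ac_sum if_distrib
          cong: if_cong)+
  moreover have "map_poly (map_poly to_ac) (separated T S) =
      separated (map_poly to_ac T) (map_poly to_ac S)" for T S :: "'a poly"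
    by (intro poly_eqI)
       (simp add: separated_def coeff_map_poly coeff_pCons split: nat.split)
  ultimately show ?thesis
    by (simp add: generalized_Hermitian_separated)
qed

lemma pderiv_Hermitian_y:
  assumes "of_nat q = (0 :: 'a :: idom)" and "k > 0"
  shows "pderiv (Hermitian_y q k :: 'a poly) = 1"
proof -
  have "pderiv (Hermitian_y q k :: 'a poly) = (\<Sum>i<k. monom (of_nat q ^ i) (q ^ i - 1))"
    by (simp add: Hermitian_y_def pderiv_sum pderiv_monom)
  also have "\<dots> = (\<Sum>i<k. if i = 0 then 1 else 0)"
    using assms by (intro sum.cong) auto
  finally show ?thesis
    using assms by simp
qed

lemma pderiv_Hermitian_x:
  assumes "of_nat q = (0 :: 'a :: idom)"
  shows "pderiv (Hermitian_x q k :: 'a poly) = (\<Sum>j\<in>{1..<k}. monom 1 (q ^ j))"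
proof -
  have "pderiv (Hermitian_x q k :: 'a poly) =
      (\<Sum>j<k. \<Sum>i<j. monom (of_nat q ^ i + of_nat q ^ j) (q ^ i + q ^ j - 1))"
    by (simp add: Hermitian_x_def pderiv_sum pderiv_monom)
  \<comment> \<open>As \<open>q\<close> vanishes in the field and \<open>j > i\<close>, the factor
    \<open>q^i + q^j\<close> is 1 for \<open>i = 0\<close> and 0 otherwise.\<close>
  also have "\<dots> = (\<Sum>j<k. \<Sum>i<j. if i = 0 then monom 1 (q ^ j) else 0)"
    using assms by (intro sum.cong) (auto simp: power_0_left)
  also have "\<dots> = (\<Sum>j<k. if j = 0 then 0 else monom 1 (q ^ j))"
    by (intro sum.cong) auto
  also have "\<dots> = (\<Sum>j\<in>{1..<k}. monom 1 (q ^ j))"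
    by (rule sum.mono_neutral_cong_right) auto
  finally show ?thesis .
qed

lemma irreducible_generalized_Hermitian:
  assumes q0: "of_nat q = (0 :: 'a :: alg_closed_field)" and q: "q \<ge> 2" and k: "k \<ge> 2"
  shows "irreducible (generalized_Hermitian q k :: 'a poly poly)"
  unfolding generalized_Hermitian_separated
proof (rule irreducible_separated)
  show "pderiv (Hermitian_y q k :: 'a poly) = 1"
    using q0 k by (intro pderiv_Hermitian_y) auto
  \<comment> \<open>The exponents \<open>q^j\<close> are distinct because \<open>q \<ge> 2\<close>,
    so the term \<open>j = k - 1\<close> is not cancelled.\<close>
  have "coeff (pderiv (Hermitian_x q k :: 'a poly)) (q ^ (k - 1)) =
      (\<Sum>j\<in>{1..<k}. if j = k - 1 then 1 else 0)"
    using q by (auto simp: pderiv_Hermitian_x[OF q0] coeff_sum intro!: sum.cong)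
  also have "\<dots> = 1"
    using k by (subst sum.delta) auto
  finally have c: "coeff (pderiv (Hermitian_x q k :: 'a poly)) (q ^ (k - 1)) = 1" .
  then show "pderiv (Hermitian_x q k :: 'a poly) \<noteq> 0"
    by auto
  have "degree (pderiv (Hermitian_x q k :: 'a poly)) \<ge> q ^ (k - 1)"
    using c by (intro le_degree) auto
  then have "2 * q ^ (k - 1) < 2 * (degree (pderiv (Hermitian_x q k :: 'a poly)) + 1)"
    by (simp only: mult_less_cancel1 less_Suc_eq_le Suc_eq_plus1[symmetric]) simp
  \<comment> \<open>A cruder bound than \<open>q^(k-1) + q^(k-2)\<close> is enough here.\<close>
  moreover have "degree (Hermitian_x q k :: 'a poly) \<le> 2 * q ^ (k - 1)"
    unfolding Hermitian_x_def
  proof (intro degree_sum_le finite_lessThan)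
    fix j i
    assume "j \<in> {..<k}" "i \<in> {..<j}"
    then have "q ^ i \<le> q ^ (k - 1)" "q ^ j \<le> q ^ (k - 1)"
      using q by (auto intro!: power_increasing)
    then show "degree (monom (1::'a) (q ^ i + q ^ j)) \<le> 2 * q ^ (k - 1)"
      by (simp add: degree_monom_eq)
  qed
  ultimately show "degree (Hermitian_x q k :: 'a poly) <
      2 * (degree (pderiv (Hermitian_x q k :: 'a poly)) + 1)"
    by (rule le_less_trans[rotated])
qed

section \<open>The Frobenius condition\<close>

text \<open>Compares the second elementary symmetric polynomial of \<open>a 1, ..., a k\<close> with
  that of \<open>a 0, ..., a (k-1)\<close>: pairs of shared entries cancel, leaving those with
  \<open>a k\<close> or \<open>a 0\<close>.\<close>

lemma sum_pairs_shift_diff: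
  fixes a :: "nat \<Rightarrow> 'a::comm_ring_1"
  assumes "k > 0"
  shows "(\<Sum>j<k. \<Sum>i<j. a (Suc i) * a (Suc j)) - (\<Sum>j<k. \<Sum>i<j. a i * a j) =
    (a k - a 0) * (\<Sum>j\<in>{1..<k}. a j)"
  using assms
proof (induction k rule: nat_induct_non_zero)
  case 1
  then show ?case by simp
next
  case (Suc k)
  define A where "A = (\<Sum>j\<in>{1..<k}. a j)"
  have 1: "(\<Sum>i<k. a i) = a 0 + A"
    using Suc.hyps by (simp add: A_def lessThan_atLeast0 sum.atLeast_Suc_lessThan)
  have "a 0 + (\<Sum>i<k. a (Suc i)) = (\<Sum>i<k. a i) + a k"
    using sum.lessThan_Suc_shift[of a k] by simp
  then have 2: "(\<Sum>i<k. a (Suc i)) = A + a k"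
    by (simp add: 1 add.assoc)
  have 3: "(\<Sum>j\<in>{1..<Suc k}. a j) = A + a k"
    using Suc.hyps by (simp add: A_def)
  show ?case
    using Suc.IH unfolding 3 A_def[symmetric]
    by (simp add: sum_distrib_right[symmetric] 1 2 algebra_simps)
qed

text \<open>Raising to the power \<open>q\<close> is additive and shifts the index \<open>i\<close>
  of each \<open>q^i\<close>; the y-part then telescopes and the x-part is
  \<open>sum_pairs_shift_diff\<close>.\<close>

lemma generalized_Hermitian_power_diff:
  fixes q k :: nat
  assumes p: "prime CHAR('a::field)" and q: "q = CHAR('a) ^ n" and k: "k > 0"
  defines "F \<equiv> generalized_Hermitian q k :: 'a poly poly"
  shows "F ^ q - F = (yvar ^ (q ^ k) - yvar)
    - (xvar ^ (q ^ k) - xvar) * (\<Sum>j\<in>{1..<k}. xvar ^ (q ^ j))"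
proof -
  define Y :: "'a poly poly" where "Y = (\<Sum>i<k. yvar ^ (q ^ i))"
  define Z :: "'a poly poly" where "Z = (\<Sum>j<k. \<Sum>i<j. xvar ^ (q ^ i) * xvar ^ (q ^ j))"
  have pow_sum: "sum f A ^ q = (\<Sum>i\<in>A. f i ^ q)" for f :: "nat \<Rightarrow> 'a poly poly" and A
    by (rule freshmans_dream_sum') (use p q in simp_all)
  have F: "F = Y - Z"
    by (simp add: F_def Y_def Z_def generalized_Hermitian_def power_add)
  \<comment> \<open>Expanding \<open>Y = F + Z\<close> rather than \<open>F = Y - Z\<close> avoids
    the sign \<open>(-1)^q\<close>.\<close>
  have "(F + Z) ^ q = F ^ q + Z ^ q"
    by (rule freshmans_dream') (use p q in simp_all)
  then have "F ^ q - F = (Y ^ q - Y) - (Z ^ q - Z)"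
    by (simp add: F)
  moreover have "Y ^ q - Y = yvar ^ (q ^ k) - yvar"
  proof -
    have "Y ^ q = (\<Sum>i<k. yvar ^ (q ^ Suc i))"
      by (simp add: Y_def pow_sum flip: power_mult) (simp add: mult.commute)
    then show ?thesis
      using sum_lessThan_telescope[of "\<lambda>i. (yvar :: 'a poly poly) ^ (q ^ i)" k]
      by (simp add: Y_def sum_subtractf)
  qed
  moreover have "Z ^ q - Z = (xvar ^ (q ^ k) - xvar) * (\<Sum>j\<in>{1..<k}. xvar ^ (q ^ j))"
  proof -
    have "Z ^ q = (\<Sum>j<k. \<Sum>i<j. xvar ^ (q ^ Suc i) * xvar ^ (q ^ Suc j))"
      by (simp add: Z_def pow_sum power_mult_distrib flip: power_mult) (simp add: mult.commute)
    then show ?thesis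
      using sum_pairs_shift_diff[OF k, of "\<lambda>i. (xvar :: 'a poly poly) ^ (q ^ i)"]
      by (simp add: Z_def)
  qed
  ultimately show ?thesis
    by simp
qed

theorem mainTheorem7:
  fixes q k :: nat
  assumes "primepow q"
    and "k \<ge> 2"
    and "CARD('a::{field,finite}) = q ^ k"
  shows "Frobenius_nonclassical (q ^ k) (generalized_Hermitian q k :: 'a poly poly)"
proof -
  define F where "F = (generalized_Hermitian q k :: 'a poly poly)"
  obtain p n where pn: "prime p" "n > 0" "q = p ^ n"
    using assms(1) by (auto simp: primepow_def)
  have prime_char: "prime CHAR('a)"
    by (rule prime_CHAR_semidom) (simp add: finite_imp_CHAR_pos)
  \<comment> \<open>The characteristic is a prime dividing the cardinality, a power of
    \<open>p\<close>.\<close>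
  have "CHAR('a) dvd p ^ (n * k)"
    using CHAR_dvd_CARD[where 'a='a] assms(3) pn by (simp add: power_mult)
  then have char: "CHAR('a) = p"
    using prime_char pn prime_dvd_power primes_dvd_imp_eq by blast
  have q0: "of_nat q = (0::'a)"
    using pn by (simp add: of_nat_eq_0_iff_char_dvd char)
  then have q0_ac: "of_nat q = (0::'a alg_closure)"
    by (metis to_ac_0 to_ac_of_nat)
  have "q \<ge> 2"
    using assms(1) primepow_gt_Suc_0[of q] by simp
  then have irred: "absolutely_irreducible F"
    unfolding absolutely_irreducible_def F_def map_to_ac_generalized_Hermitian
    using q0_ac assms(2) by (intro irreducible_generalized_Hermitian)
  have "partial_y F = 1"
    unfolding F_def generalized_Hermitian_separated
    using q0 assms(2) by (intro partial_y_separated pderiv_Hermitian_y) auto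
  moreover have "partial_x F = - (\<Sum>j\<in>{1..<k}. xvar ^ (q ^ j))"
    by (simp add: F_def generalized_Hermitian_separated partial_x_separated
        pderiv_Hermitian_x[OF q0] xvar_power const_poly_sum)
  \<comment> \<open>With \<open>partial_y F = 1\<close> and \<open>partial_x F\<close> equal to
    minus the sum of the \<open>x^(q^j)\<close>, the left side is exactly the formula for
    \<open>F^q - F\<close>.\<close>
  ultimately have "(xvar ^ (q ^ k) - xvar) * partial_x F + (yvar ^ (q ^ k) - yvar) * partial_y F =
      F ^ q - F"
    using generalized_Hermitian_power_diff[OF prime_char, of q n k] char pn assms(2)
    by (simp add: F_def)
  moreover have "F dvd F ^ q - F"
    using \<open>q \<ge> 2\<close> by (intro dvd_diff dvd_power) auto
  ultimately show ?thesis
    using irred assms(3) by (simp add: Frobenius_nonclassical_def F_def)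
qed

end
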